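(* Let $d\ge 1$, let $S_{2d}$ be a constant real skew-symmetric $2d\times 2d$ matrix, let $H:\mathbb{R}^d\times\mathbb{R}^d\to\mathbb{R}$, $(p,q)\mapsto H(p,q)$, be sufficiently differentiable, and let $\tau>0$. Consider the partitioned average vector field (PAVF) method $$ \frac{1}{\tau}\begin{pmatrix} p^{n+1}-p^{n}\\ q^{n+1}-q^{n}\end{pmatrix} =S_{2d}\begin{pmatrix}\int_0^1 H_p\big(\xi p^{n+1}+(1-\xi)p^n,\;q^n\big)\,d\xi\\[2pt] \int_0^1 H_q\big(p^{n+1},\;\xi q^{n+1}+(1-\xi)q^n\big)\,d\xi\end{pmatrix} $$ for the Hamiltonian system $(\dot p,\dot q)^T=S_{2d}\,(H_p(p,q),H_q(p,q))^T$. Then the method preserves the Hamiltonian exactly: whenever $z^n=(p^n,q^n)$ and $z^{n+1}=(p^{n+1},q^{n+1})$ in $\mathbb{R}^d\times\mathbb{R}^d$ satisfy $$ \frac{1}{\tau}\begin{pmatrix} p^{n+1}-p^{n}\\ q^{n+1}-q^{n}\end{pmatrix} =S_{2d}\begin{pmatrix}\int_0^1 H_p\big(\xi p^{n+1}+(1-\xi)p^n,\;q^n\big)\,d\xi\\[2pt] \int_0^1 H_q\big(p^{n+1},\;\xi q^{n+1}+(1-\xi)q^n\big)\,d\xi\end{pmatrix}, $$ one has $$\frac{1}{\tau}\big(H(z^{n+1})-H(z^n)\big)=0 .$$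
   Context: $H_p$ and $H_q$ denote the gradients (column vectors in $\mathbb{R}^d$) of $H$ with respect to $p$ and $q$. "Sufficiently differentiable" is the paper's standing assumption on $H$; in particular $H$ is continuously differentiable. $\tau$ is the time step. The vector integrals are taken componentwise. *)

theory Defs
  imports "HOL-Analysis.Analysis"
begin

text \<open>Only meaningful where \<open>f\<close> is differentiable; there the gradient is unique
  (\<open>gradient_eqI\<close> below).\<close>

definition gradient :: "('a::real_inner \<Rightarrow> real) \<Rightarrow> 'a \<Rightarrow> 'a"
  where "gradient f x = (THE D. GDERIV f x :> D)"

lemma gradient_eqI:
  assumes "GDERIV f x :> D"
  shows "gradient f x = D"
  unfolding gradient_def
proof (rule the_equality)
  fix E assume "GDERIV f x :> E"
  with assms have "(\<lambda>h. inner h E) = (\<lambda>h. inner h D)"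
    unfolding gderiv_def by (rule has_derivative_unique[rotated])
  then have "inner h (E - D) = 0" for h
    by (metis inner_diff_right right_minus_eq)
  then show "E = D"
    by (metis inner_eq_zero_iff right_minus_eq)
qed (rule assms)

definition continuously_differentiable :: "('a::euclidean_space \<Rightarrow> real) \<Rightarrow> bool"
  where "continuously_differentiable f \<longleftrightarrow>
    (\<forall>x. f differentiable (at x)) \<and> continuous_on UNIV (gradient f)"

definition grad_p :: "((real^'d) \<times> (real^'d) \<Rightarrow> real) \<Rightarrow> real^'d \<Rightarrow> real^'d \<Rightarrow> real^'d"
  where "grad_p H p q = gradient (\<lambda>x. H (x, q)) p"

definition grad_q :: "((real^'d) \<times> (real^'d) \<Rightarrow> real) \<Rightarrow> real^'d \<Rightarrow> real^'d \<Rightarrow> real^'d"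
  where "grad_q H p q = gradient (\<lambda>y. H (p, y)) q"

text \<open>Vectors of length \<open>2d\<close> and \<open>2d \<times> 2d\<close> matrices are indexed by the disjoint sum
  \<open>'d + 'd\<close>: the left summand is the \<open>p\<close> block, the right summand the \<open>q\<close> block.\<close>

definition stack :: "real^'d \<Rightarrow> real^'d \<Rightarrow> real^('d + 'd)"
  where "stack u v = (\<chi> i. case i of Inl j \<Rightarrow> u $ j | Inr j \<Rightarrow> v $ j)"

definition skew_symmetric :: "real^'n^'n \<Rightarrow> bool"
  where "skew_symmetric A \<longleftrightarrow> transpose A = - A"

text \<open>One step of the PAVF method, as a relation: the scheme is implicit, and solvability for
  the new state is not claimed.\<close>

definition pavf_step ::
  "real^('d + 'd)^('d + 'd) \<Rightarrow> ((real^'d) \<times> (real^'d) \<Rightarrow> real) \<Rightarrow> real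
    \<Rightarrow> (real^'d) \<times> (real^'d) \<Rightarrow> (real^'d) \<times> (real^'d) \<Rightarrow> bool"
  where "pavf_step S H \<tau> = (\<lambda>(p, q) (p', q').
    (1 / \<tau>) *\<^sub>R stack (p' - p) (q' - q) =
      S *v stack (integral {0..1} (\<lambda>\<xi>. grad_p H (\<xi> *\<^sub>R p' + (1 - \<xi>) *\<^sub>R p) q))
                 (integral {0..1} (\<lambda>\<xi>. grad_q H p' (\<xi> *\<^sub>R q' + (1 - \<xi>) *\<^sub>R q))))"

end

(* Going from (p, q) to (p', q') along the two segments through (p', q), each segment contributes
   the increment in one block paired with exactly the averaged partial gradient that the scheme
   uses.  Hence H(z') - H(z) is the pairing of tau * S w with w, w being the stacked averaged
   gradients, and this vanishes because S is skew. *)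
theory Submission
  imports Defs
begin

text \<open>Riesz representation in finite dimension: a linear functional is the inner product with
  the vector whose coordinates are its values on \<open>Basis\<close>. This guarantees that the
  \<open>THE\<close> in \<open>gradient\<close> denotes an actual gradient.\<close>

lemma GDERIV_gradient:
  fixes f :: "'a::euclidean_space \<Rightarrow> real"
  assumes "f differentiable (at x)"
  shows "GDERIV f x :> gradient f x"
proof -
  from assms obtain f' where f': "(f has_derivative f') (at x)"
    by (auto simp: differentiable_def)
  interpret linear f'
    using f' by (rule has_derivative_linear)
  have "f' h = h \<bullet> (\<Sum>b\<in>Basis. f' b *\<^sub>R b)" for h
  proof -
    have "f' h = f' (\<Sum>b\<in>Basis. (h \<bullet> b) *\<^sub>R b)"
      by (simp add: euclidean_representation)
    also have "\<dots> = h \<bullet> (\<Sum>b\<in>Basis. f' b *\<^sub>R b)"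
      by (simp add: sum scale inner_sum_right mult.commute)
    finally show ?thesis .
  qed
  then have "f' = (\<lambda>h. h \<bullet> (\<Sum>b\<in>Basis. f' b *\<^sub>R b))"
    by blast
  with f' have "GDERIV f x :> (\<Sum>b\<in>Basis. f' b *\<^sub>R b)"
    unfolding gderiv_def by metis
  then show ?thesis
    using gradient_eqI by metis
qed

text \<open>The fundamental theorem of calculus along the segment from \<open>a\<close> to
  \<open>b\<close>. Its velocity is the constant \<open>b - a\<close>, which therefore leaves the
  integral and pairs with the averaged gradient.\<close>

lemma gradient_line_integral:
  fixes f :: "'a::euclidean_space \<Rightarrow> real"
  assumes f: "\<And>x. GDERIV f x :> g x" and g: "continuous_on UNIV g"
  shows "f b - f a = (b - a) \<bullet> integral {0..1} (\<lambda>\<xi>. g (\<xi> *\<^sub>R b + (1 - \<xi>) *\<^sub>R a))"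
proof -
  define \<gamma> :: "real \<Rightarrow> 'a" where "\<gamma> \<xi> = \<xi> *\<^sub>R b + (1 - \<xi>) *\<^sub>R a" for \<xi>
  have "((\<lambda>\<xi>. f (\<gamma> \<xi>)) has_vector_derivative (b - a) \<bullet> g (\<gamma> \<xi>)) (at \<xi> within {0..1})" for \<xi>
  proof -
    have \<gamma>: "(\<gamma> has_derivative (\<lambda>h. h *\<^sub>R (b - a))) (at \<xi> within {0..1})"
      unfolding \<gamma>_def by (auto intro!: derivative_eq_intros simp: algebra_simps)
    have "(f has_derivative (\<lambda>h. h \<bullet> g (\<gamma> \<xi>))) (at (\<gamma> \<xi>))"
      using f by (simp add: gderiv_def)
    from has_derivative_compose[OF \<gamma> this] show ?thesis
      by (simp add: has_vector_derivative_def)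
  qed
  then have "((\<lambda>\<xi>. (b - a) \<bullet> g (\<gamma> \<xi>)) has_integral f (\<gamma> 1) - f (\<gamma> 0)) {0..1}"
    by (intro fundamental_theorem_of_calculus) auto
  \<comment> \<open>Continuity of \<open>g\<close> makes the vector-valued integral exist, so that
    the bounded linear map "inner product with \<open>b - a\<close>" commutes with it.\<close>
  moreover have "(\<lambda>\<xi>. g (\<gamma> \<xi>)) integrable_on {0..1}"
    unfolding \<gamma>_def
    by (intro integrable_continuous_real continuous_on_compose2[OF g] continuous_intros) auto
  then have "((\<lambda>\<xi>. (b - a) \<bullet> g (\<gamma> \<xi>)) has_integral
      (b - a) \<bullet> integral {0..1} (\<lambda>\<xi>. g (\<gamma> \<xi>))) {0..1}"
    using has_integral_linear[OF integrable_integral bounded_linear_inner_right]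
    by (fastforce simp: o_def)
  ultimately have "f (\<gamma> 1) - f (\<gamma> 0) = (b - a) \<bullet> integral {0..1} (\<lambda>\<xi>. g (\<gamma> \<xi>))"
    by (rule has_integral_unique)
  then show ?thesis
    by (simp add: \<gamma>_def)
qed

text \<open>Chain rule with the affine embedding of the first factor: pairing \<open>(h, 0)\<close>
  with \<open>D\<close> leaves only the first block of \<open>D\<close>.\<close>

lemma GDERIV_fst_section:
  assumes "GDERIV H (p, q) :> D"
  shows "GDERIV (\<lambda>x. H (x, q)) p :> fst D"
proof -
  have "((\<lambda>x. (x, q)) has_derivative (\<lambda>h. (h, 0))) (at p)"
    by (auto intro!: derivative_eq_intros)
  from has_derivative_compose[OF this] assms show ?thesis
    by (fastforce simp: gderiv_def inner_prod_def)
qed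

lemma GDERIV_snd_section:
  assumes "GDERIV H (p, q) :> D"
  shows "GDERIV (\<lambda>y. H (p, y)) q :> snd D"
proof -
  have "((\<lambda>y. (p, y)) has_derivative (\<lambda>h. (0, h))) (at q)"
    by (auto intro!: derivative_eq_intros)
  from has_derivative_compose[OF this] assms show ?thesis
    by (fastforce simp: gderiv_def inner_prod_def)
qed

lemma inner_stack: "stack a b \<bullet> stack c d = a \<bullet> c + b \<bullet> d"
proof -
  \<comment> \<open>The index type is a disjoint sum; exposing this as \<open><+>\<close> lets the
    sum split into the two blocks.\<close>
  have "(\<Sum>i\<in>UNIV. stack a b $ i * stack c d $ i) =
      (\<Sum>i\<in>UNIV <+> UNIV. stack a b $ i * stack c d $ i)"
    by simp
  also have "\<dots> = (\<Sum>i\<in>UNIV. a $ i * c $ i) + (\<Sum>i\<in>UNIV. b $ i * d $ i)"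
    by (subst sum.Plus) (auto simp: stack_def)
  finally show ?thesis
    by (simp add: inner_vec_def)
qed

text \<open>Moving \<open>S\<close> to the other factor turns it into its transpose, which is
  \<open>- S\<close>, so the quadratic form equals its own negative.\<close>

lemma skew_symmetric_inner_eq_0:
  assumes "skew_symmetric S"
  shows "(S *v v) \<bullet> v = 0"
proof -
  have "(S *v v) \<bullet> v = (transpose S *v v) \<bullet> v"
    by (metis dot_lmul_matrix inner_commute transpose_matrix_vector)
  also have "\<dots> = - ((S *v v) \<bullet> v)"
    using assms scaleR_matrix_vector_assoc[of "- 1" S v]
    by (simp add: skew_symmetric_def flip: inner_minus_left)
  finally show ?thesis by simp
qed

theorem theorem2p1:
  fixes S :: "real^('d::finite + 'd)^('d + 'd)"
    and H :: "(real^'d) \<times> (real^'d) \<Rightarrow> real"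
    and \<tau> :: real
    and p q p' q' :: "real^'d"
  assumes "skew_symmetric S"
    and "continuously_differentiable H"
    and "\<tau> > 0"
    and "pavf_step S H \<tau> (p, q) (p', q')"
  shows "(1 / \<tau>) * (H (p', q') - H (p, q)) = 0"
proof -
  have deriv: "GDERIV H z :> gradient H z" for z
    using assms(2) by (intro GDERIV_gradient) (auto simp only: continuously_differentiable_def)
  have cont: "continuous_on UNIV (gradient H)"
    using assms(2) by (simp add: continuously_differentiable_def)
  \<comment> \<open>Identifying the partial gradients with blocks of the full gradient lets them
    inherit its continuity.\<close>
  have p_deriv: "GDERIV (\<lambda>x. H (x, b)) a :> grad_p H a b"
    and grad_p: "grad_p H a b = fst (gradient H (a, b))" for a b
    using GDERIV_fst_section[OF deriv] gradient_eqI unfolding grad_p_def by metis+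
  have q_deriv: "GDERIV (\<lambda>y. H (a, y)) b :> grad_q H a b"
    and grad_q: "grad_q H a b = snd (gradient H (a, b))" for a b
    using GDERIV_snd_section[OF deriv] gradient_eqI unfolding grad_q_def by metis+
  have p_cont: "continuous_on UNIV (\<lambda>x. grad_p H x q)"
    and q_cont: "continuous_on UNIV (grad_q H p')"
    unfolding grad_p grad_q by (intro continuous_intros continuous_on_compose2[OF cont]; simp)+
  define u where "u = integral {0..1} (\<lambda>\<xi>. grad_p H (\<xi> *\<^sub>R p' + (1 - \<xi>) *\<^sub>R p) q)"
  define v where "v = integral {0..1} (\<lambda>\<xi>. grad_q H p' (\<xi> *\<^sub>R q' + (1 - \<xi>) *\<^sub>R q))"
  have "H (p', q) - H (p, q) = (p' - p) \<bullet> u"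
    unfolding u_def by (rule gradient_line_integral[OF p_deriv p_cont])
  moreover have "H (p', q') - H (p', q) = (q' - q) \<bullet> v"
    unfolding v_def by (rule gradient_line_integral[OF q_deriv q_cont])
  ultimately have "H (p', q') - H (p, q) = stack (p' - p) (q' - q) \<bullet> stack u v"
    by (simp add: inner_stack)
  \<comment> \<open>The factor is placed on the stacked increment so that the left side of the
    scheme appears literally and can be replaced by \<open>S *v stack u v\<close>.\<close>
  then have "(1 / \<tau>) * (H (p', q') - H (p, q)) =
      ((1 / \<tau>) *\<^sub>R stack (p' - p) (q' - q)) \<bullet> stack u v"
    by simp
  also have "\<dots> = (S *v stack u v) \<bullet> stack u v"
    using assms(4) by (simp add: pavf_step_def u_def v_def)
  also have "\<dots> = 0"
    using assms(1) by (rule skew_symmetric_inner_eq_0)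
  finally show ?thesis .
qed

end
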